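(* Consider a code ensemble $\mathscr C$ of binary linear block codes of length $n$ with probability distribution $\Pr\{\mathcal C\}$, $\mathcal C\in\mathscr C$, used with BPSK over an AWGN channel with noise variance $\sigma^2>0$ per component. Let $\{A_d^{\mathcal C}\}$ be the weight spectrum of a specific code $\mathcal C$, and let $A_d=\sum_{\mathcal C}\Pr\{\mathcal C\}A_d^{\mathcal C}$ be the average weight spectrum. For integers $d\ge1$ and $0\le d^*\le n$ define $$h(A_d)=\min\Big\{A_d\,Q(\sqrt d/\sigma)\,B(p_b,n-d,0,d^*-1),\ \ (A_d-1)\Big(Q(\sqrt d/\sigma)-\tfrac12Q^2(\sqrt d/\sigma)\Big)B(p_b,n-2d,0,d^*-1)+Q(\sqrt d/\sigma)\Big\}.$$ Then $$\Pr\{E_d,\ W_H(\hat{\underline y})\le d^*\}\le h(A_d).$$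
   Context: Channel: a code $\mathcal C$ is drawn from the ensemble, independently of the noise; codewords are mapped by $\phi:\mathbb F_2^n\to\{-1,+1\}^n$, $\phi(\underline v)_t=1-2v_t$. The all-zero codeword $\underline c^{(0)}$ is transmitted; the received vector is $\underline y=\phi(\underline c^{(0)})+\underline z$, with $\underline z$ having i.i.d. $\mathcal N(0,\sigma^2)$ components. $E_d$ is the event that at least one codeword of $\mathcal C$ of Hamming weight $d$ has its image under $\phi$ nearer to $\underline y$ (in Euclidean distance) than $\phi(\underline c^{(0)})$. The hard-decision vector $\hat{\underline y}\in\mathbb F_2^n$ is given by $\hat y_t=0$ if $y_t>0$ and $\hat y_t=1$ if $y_t\le0$; $W_H$ is Hamming weight; $A_d^{\mathcal C}$ is the number of codewords of $\mathcal C$ of Hamming weight $d$. Probabilities for the ensemble are averages: $\Pr\{\cdot\}=\sum_{\mathcal C}\Pr\{\mathcal C\}\Pr\{\cdot\mid\mathcal C\}$. Notation: $Q(x)=\int_x^{\infty}\frac1{\sqrt{2\pi}}e^{-z^2/2}\,dz$; $p_b=Q(1/\sigma)$; $B(p,N_t,N_\ell,N_u)=\sum_{m=N_\ell}^{N_u}\binom{N_t}{m}p^m(1-p)^{N_t-m}$, i.e. the probability that the number of bit errors in a binary vector of total length $N_t$, passed through a binary symmetric channel with crossover probability $p$, ranges from $N_\ell$ to $N_u$ (an empty sum is $0$).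
   Formalization: When 2d > n the length n−2d in B is negative and the stated bound is undefined (read literally it fails, e.g. n=3, d=2, d*=2, even-weight code, large σ); there n−2d is read as max(n−2d, 0), and likewise n−d when d > n. *)

theory Defs
  imports "HOL-Probability.Probability" "HOL-Library.Z2"
begin

definition Q :: "real \<Rightarrow> real" where
  "Q x = (LBINT z:{x..}. 1 / sqrt (2 * pi) * exp (- z\<^sup>2 / 2))"

text \<open>The bounds on the number of errors are integers, so that the range from 0 to
  \<open>d\<^sup>* - 1\<close> is empty for \<open>d\<^sup>* = 0\<close>.  Summands with \<open>m > N\<^sub>t\<close> vanish with the binomial
  coefficient.\<close>

definition B :: "real \<Rightarrow> nat \<Rightarrow> int \<Rightarrow> int \<Rightarrow> real" where
  "B p Nt Nl Nu =
    (\<Sum>m | Nl \<le> int m \<and> int m \<le> Nu. real (Nt choose m) * p ^ m * (1 - p) ^ (Nt - m))"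

text \<open>The lengths \<open>n - d\<close> and \<open>n - 2 * d\<close> are truncated subtractions: a negative
  length is read as the length 0 of an empty vector.\<close>

definition h :: "real \<Rightarrow> nat \<Rightarrow> nat \<Rightarrow> nat \<Rightarrow> real \<Rightarrow> real" where
  "h \<sigma> n d dstar A =
    (let q = Q (sqrt (real d) / \<sigma>); p\<^sub>b = Q (1 / \<sigma>) in
      min (A * q * B p\<^sub>b (n - d) 0 (int dstar - 1))
          ((A - 1) * (q - 1 / 2 * q\<^sup>2) * B p\<^sub>b (n - 2 * d) 0 (int dstar - 1) + q))"

definition hamming_weight :: "bit ^ 'n \<Rightarrow> nat" where
  "hamming_weight v = card {t. v $ t \<noteq> 0}"

definition bpsk :: "bit ^ 'n \<Rightarrow> real ^ 'n" where
  "bpsk v = (\<chi> t. 1 - 2 * of_bool (v $ t = 1))"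

definition received :: "real ^ 'n \<Rightarrow> real ^ 'n" where
  "received z = bpsk 0 + z"

definition hard_decision :: "real ^ 'n \<Rightarrow> bit ^ 'n" where
  "hard_decision y = (\<chi> t. if y $ t > 0 then 0 else 1)"

definition weight_spectrum :: "(bit ^ 'n) set \<Rightarrow> nat \<Rightarrow> nat" where
  "weight_spectrum C d = card {c \<in> C. hamming_weight c = d}"

definition error_event :: "nat \<Rightarrow> (bit ^ 'n) set \<Rightarrow> real ^ 'n \<Rightarrow> bool" where
  "error_event d C y \<longleftrightarrow>
    (\<exists>c\<in>C. hamming_weight c = d \<and> dist y (bpsk c) < dist y (bpsk 0))"

text \<open>An ensemble is a probability mass function on codes.  There are only finitely many
  subsets of \<open>bit ^ 'n\<close>, so the sums over the support are finite.\<close>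

definition average_weight_spectrum :: "(bit ^ 'n) set pmf \<Rightarrow> nat \<Rightarrow> real" where
  "average_weight_spectrum P d = (\<Sum>C\<in>set_pmf P. pmf P C * real (weight_spectrum C d))"

text \<open>The code is drawn independently of the noise, which lives on \<open>M\<close>.  Hence the
  conditional probability of an event given the code \<open>C\<close> is its probability in \<open>M\<close> with
  \<open>C\<close> held fixed.\<close>

definition ensemble_prob ::
    "(bit ^ 'n) set pmf \<Rightarrow> 'w measure \<Rightarrow> ((bit ^ 'n) set \<Rightarrow> 'w \<Rightarrow> bool) \<Rightarrow> real" where
  "ensemble_prob P M X = (\<Sum>C\<in>set_pmf P. pmf P C * measure M {\<omega> \<in> space M. X C \<omega>})"

end

theory Submission imports Defs begin

text \<open>
  A word \<open>c\<close> of weight \<open>d\<close> with support \<open>S\<close> is nearer to the received vector than the zero word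
  iff the noise summed over \<open>S\<close> is below \<open>-d\<close>, which has probability \<open>q = Q (sqrt d / \<sigma>)\<close>.
  Such an event forces a bit error inside \<open>S\<close>, hence leaves at most \<open>d\<^sup>* - 1\<close> errors on any
  set of coordinates disjoint from \<open>S\<close>, and these errors are independent of it.  The union bound
  with the complements of the supports gives the first term of the minimum.

  For the second term, fix one word of weight \<open>d\<close>, with support \<open>S\<^sub>0\<close>, and bound its event by \<open>q\<close>.
  Every other word contributes at most the probability that it is nearer than the zero word while
  the fixed word is not.  The two events share the noise on \<open>S \<inter> S\<^sub>0\<close> and are conditionally
  independent and equiprobable given it, so both occur with probability at least \<open>q\<^sup>2\<close>, and the
  contribution is at most \<open>q - q\<^sup>2 \<le> q - q\<^sup>2 / 2\<close>.  The errors are counted on \<open>n - 2 d\<close> coordinates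
  outside \<open>S \<union> S\<^sub>0\<close>.

  Both bounds are affine in the number of words of weight \<open>d\<close>, so they survive averaging over the
  ensemble.
\<close>

subsection \<open>Gaussian tails, binomial sums and product measures\<close>

text \<open>A single point is a null set, so the closed and the open tail agree. Both are wanted: a
  bit error is a non-strict inequality, a nearer codeword a strict one.\<close>

lemma prob_std_normal_tail:
  assumes "prob_space M" and D: "distributed M lborel V std_normal_density"
  shows "measure M {\<omega> \<in> space M. V \<omega> \<ge> x} = Q x"
    and "measure M {\<omega> \<in> space M. V \<omega> > x} = Q x"
proof -
  interpret prob_space M by fact
  have eq: "measure M (V -` A \<inter> space M) = (LBINT z:A. std_normal_density z)"
    if "A \<in> sets lborel" for A
  proof -
    have "emeasure M (V -` A \<inter> space M) = (\<integral>\<^sup>+z. ennreal (std_normal_density z) * indicator A z \<partial>lborel)"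
      using distributed_emeasure[OF D that] by simp
    also have "\<dots> = (\<integral>\<^sup>+z. ennreal (indicator A z * std_normal_density z) \<partial>lborel)"
      by (intro nn_integral_cong) (auto split: split_indicator)
    also have "\<dots> = ennreal (LBINT z:A. std_normal_density z)"
      unfolding set_lebesgue_integral_def real_scaleR_def
    proof (rule nn_integral_eq_integral)
      have "integrable lborel (\<lambda>z. indicator A z *\<^sub>R std_normal_density z)"
        using that by (intro integrable_mult_indicator) auto
      then show "integrable lborel (\<lambda>z. indicator A z * std_normal_density z)" by simp
    qed auto
    finally show ?thesis
      by (simp add: measure_def set_lebesgue_integral_def)
  qed
  have Q: "Q x = (LBINT z:{x..}. std_normal_density z)"
    by (simp add: Q_def std_normal_density_def)
  have *: "(LBINT z:{x<..}. std_normal_density z) = (LBINT z:{x..}. std_normal_density z)"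
    unfolding set_lebesgue_integral_def
  proof (rule integral_cong_AE)
    show "AE z in lborel. indicator {x<..} z *\<^sub>R std_normal_density z
      = indicator {x..} z *\<^sub>R std_normal_density z"
      using AE_lborel_singleton[of x] by eventually_elim (auto split: split_indicator)
  qed auto
  show "measure M {\<omega> \<in> space M. V \<omega> \<ge> x} = Q x"
    using eq[of "{x..}"] Q by (simp add: vimage_def Int_def conj_commute)
  show "measure M {\<omega> \<in> space M. V \<omega> > x} = Q x"
    using eq[of "{x<..}"] Q * by (simp add: vimage_def Int_def conj_commute)
qed

text \<open>\<open>Q x\<close> is a tail probability of the identity on the real line under the
  standard normal law.\<close>

lemma Q_bounds: "0 \<le> Q x" "Q x \<le> 1"
proof -
  interpret N: prob_space "density lborel std_normal_density"
    by (rule prob_space_normal_density) simp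
  have "distributed (density lborel std_normal_density) lborel (\<lambda>x. x) std_normal_density"
    by (simp add: distributed_def distr_id2)
  from prob_std_normal_tail(1)[OF N.prob_space_axioms this, of x]
  show "0 \<le> Q x" "Q x \<le> 1"
    using measure_nonneg N.prob_le_1 by metis+
qed

lemma B_bounds:
  assumes "0 \<le> p" "p \<le> 1"
  shows "0 \<le> B p N l u" "B p N l u \<le> 1"
proof -
  let ?f = "\<lambda>m. real (N choose m) * p ^ m * (1 - p) ^ (N - m)"
  let ?I = "{m. l \<le> int m \<and> int m \<le> u}"
  have f: "0 \<le> ?f m" for m
    using assms by simp
  then show "0 \<le> B p N l u"
    unfolding B_def by (intro sum_nonneg) auto
  have fin: "finite ?I"
    by (rule finite_subset[of _ "{..nat u}"]) auto
  \<comment> \<open>\<open>u\<close> may exceed \<open>N\<close>, so the range is enlarged to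
    \<open>?I \<union> {..N}\<close>. The terms beyond \<open>N\<close> vanish, and what is left is
    a full binomial expansion.\<close>
  have "B p N l u \<le> sum ?f (?I \<union> {..N})"
    unfolding B_def using fin f by (intro sum_mono2) auto
  also have "\<dots> = sum ?f {..N}"
    using fin by (intro sum.mono_neutral_right) auto
  also have "\<dots> = (p + (1 - p)) ^ N"
    by (subst binomial_ring) simp
  finally show "B p N l u \<le> 1" by simp
qed

text \<open>Multiplication by \<open>- 1 / s\<close> turns the lower tail into an upper tail of the
  standard normal law.\<close>

lemma prob_normal_tail:
  assumes M: "prob_space M" and "0 < s" and D: "distributed M lborel V (normal_density 0 s)"
  shows "measure M {\<omega> \<in> space M. V \<omega> \<le> - a} = Q (a / s)"
    and "measure M {\<omega> \<in> space M. V \<omega> < - a} = Q (a / s)"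
proof -
  interpret prob_space M by fact
  have D': "distributed M lborel (\<lambda>\<omega>. - (V \<omega> / s)) std_normal_density"
    using normal_density_affine[OF D \<open>0 < s\<close>, of "- 1 / s" 0] \<open>0 < s\<close> by simp
  have "V \<omega> \<le> - a \<longleftrightarrow> a / s \<le> - (V \<omega> / s)" "V \<omega> < - a \<longleftrightarrow> a / s < - (V \<omega> / s)" for \<omega>
    using \<open>0 < s\<close> by (auto simp: field_simps)
  then show "measure M {\<omega> \<in> space M. V \<omega> \<le> - a} = Q (a / s)"
      "measure M {\<omega> \<in> space M. V \<omega> < - a} = Q (a / s)"
    using prob_std_normal_tail[OF M D', of "a / s"] by simp_all
qed

text \<open>Independence is expressed by factoring the joint law because \<open>f\<close> and
  \<open>g\<close> may have different value types: later \<open>f\<close> is one sum and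
  \<open>g\<close> a pair of sums.\<close>

lemma (in prob_space) distr_pair_compose_indep:
  assumes ind: "indep_var S X T Y" and [measurable]: "f \<in> measurable S S'" "g \<in> measurable T T'"
  shows "distr M (S' \<Otimes>\<^sub>M T') (\<lambda>\<omega>. (f (X \<omega>), g (Y \<omega>)))
    = distr M S' (\<lambda>\<omega>. f (X \<omega>)) \<Otimes>\<^sub>M distr M T' (\<lambda>\<omega>. g (Y \<omega>))"
proof -
  have [measurable]: "X \<in> measurable M S" "Y \<in> measurable M T"
    using indep_var_rv1[OF ind] indep_var_rv2[OF ind] by auto
  have *: "distr (distr M S X) S' f = distr M S' (\<lambda>\<omega>. f (X \<omega>))"
    "distr (distr M T Y) T' g = distr M T' (\<lambda>\<omega>. g (Y \<omega>))"
    by (auto simp: distr_distr comp_def)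
  interpret T: prob_space "distr M T' (\<lambda>\<omega>. g (Y \<omega>))"
    by (rule prob_space_distr) simp
  have "distr M S' (\<lambda>\<omega>. f (X \<omega>)) \<Otimes>\<^sub>M distr M T' (\<lambda>\<omega>. g (Y \<omega>))
      = distr (distr M S X \<Otimes>\<^sub>M distr M T Y) (S' \<Otimes>\<^sub>M T') (\<lambda>(x, y). (f x, g y))"
    unfolding *[symmetric]
    by (rule pair_measure_distr) (auto simp: * T.sigma_finite_measure_axioms)
  also have "\<dots> = distr M (S' \<Otimes>\<^sub>M T') (\<lambda>\<omega>. (f (X \<omega>), g (Y \<omega>)))"
    using ind[unfolded indep_var_distribution_eq] by (simp add: distr_distr comp_def)
  finally show ?thesis by simp
qed

text \<open>Tonelli's theorem in real values: the measures of the sections are bounded by 1, hence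
  integrable.\<close>

lemma (in pair_prob_space) measure_eq_integral_measure:
  assumes [measurable]: "A \<in> sets (M1 \<Otimes>\<^sub>M M2)"
  shows "measure (M1 \<Otimes>\<^sub>M M2) A = (\<integral>x. measure M2 (Pair x -` A) \<partial>M1)"
proof -
  have "emeasure (M1 \<Otimes>\<^sub>M M2) A = (\<integral>\<^sup>+x. ennreal (measure M2 (Pair x -` A)) \<partial>M1)"
    by (simp add: M2.emeasure_pair_measure_alt M2.emeasure_eq_measure)
  also have "\<dots> = ennreal (\<integral>x. measure M2 (Pair x -` A) \<partial>M1)"
  proof (rule nn_integral_eq_integral)
    have "(\<lambda>x. measure M2 (Pair x -` A)) \<in> borel_measurable M1"
      using M2.measurable_emeasure_Pair[OF assms] unfolding measure_def by measurable
    then show "integrable M1 (\<lambda>x. measure M2 (Pair x -` A))"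
      by (intro M1.integrable_const_bound[where B=1]) auto
  qed auto
  finally show ?thesis
    by (simp add: measure_def)
qed

text \<open>Given \<open>W = x\<close>, the two events are independent with the same probability \<open>g x\<close>, so the
  joint probability is the mean of \<open>g\<^sup>2\<close>, which exceeds the squared mean of \<open>g\<close> by the
  variance of \<open>g\<close>.\<close>

lemma (in prob_space) prob_shared_summand_ge:
  fixes W V V' :: "'a \<Rightarrow> real"
  assumes [measurable]: "W \<in> borel_measurable M"
    and ind: "distr M (borel \<Otimes>\<^sub>M (borel \<Otimes>\<^sub>M borel)) (\<lambda>\<omega>. (W \<omega>, V \<omega>, V' \<omega>))
      = distr M borel W \<Otimes>\<^sub>M distr M (borel \<Otimes>\<^sub>M borel) (\<lambda>\<omega>. (V \<omega>, V' \<omega>))"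
    and ind': "indep_var borel V borel V'"
    and eq: "distr M borel V' = distr M borel V"
  shows "(prob {\<omega> \<in> space M. W \<omega> + V \<omega> < a})\<^sup>2
    \<le> prob {\<omega> \<in> space M. W \<omega> + V \<omega> < a \<and> W \<omega> + V' \<omega> < a}"
proof -
  have [measurable]: "V \<in> borel_measurable M" "V' \<in> borel_measurable M"
    using indep_var_rv1[OF ind'] indep_var_rv2[OF ind'] by auto
  define \<mu> where "\<mu> = distr M borel W"
  define \<nu> where "\<nu> = distr M borel V"
  interpret \<mu>: prob_space \<mu> unfolding \<mu>_def by (rule prob_space_distr) simp
  interpret \<nu>: prob_space \<nu> unfolding \<nu>_def by (rule prob_space_distr) simp
  interpret \<nu>\<nu>: pair_prob_space \<nu> \<nu> ..
  have times: "measure (\<nu> \<Otimes>\<^sub>M \<nu>) (A \<times> A') = measure \<nu> A * measure \<nu> A'"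
    if "A \<in> sets borel" "A' \<in> sets borel" for A A'
    using \<nu>.emeasure_pair_measure_Times[of A \<nu> A'] that
    by (simp add: measure_def enn2real_mult \<nu>_def)
  have [measurable_cong, simp]: "sets \<mu> = sets borel" "sets \<nu> = sets borel"
    by (auto simp: \<mu>_def \<nu>_def)
  have [simp]: "space \<mu> = UNIV" "space \<nu> = UNIV"
    by (auto simp: \<mu>_def \<nu>_def)
  define g where "g x = measure \<nu> {y. x + y < a}" for x
  have g_meas [measurable]: "g \<in> borel_measurable borel"
    unfolding g_def by measurable
  have g: "0 \<le> g x" "g x \<le> 1" for x
    by (auto simp: g_def)
  have pair: "distr M (borel \<Otimes>\<^sub>M borel) (\<lambda>\<omega>. (V \<omega>, V' \<omega>)) = \<nu> \<Otimes>\<^sub>M \<nu>"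
    using ind'[unfolded indep_var_distribution_eq] eq by (simp add: \<nu>_def)
  have triple: "distr M (borel \<Otimes>\<^sub>M (borel \<Otimes>\<^sub>M borel)) (\<lambda>\<omega>. (W \<omega>, V \<omega>, V' \<omega>)) = \<mu> \<Otimes>\<^sub>M (\<nu> \<Otimes>\<^sub>M \<nu>)"
    using ind by (simp add: \<mu>_def pair)
  interpret P: pair_prob_space \<mu> "\<nu> \<Otimes>\<^sub>M \<nu>" ..
  have joint: "prob {\<omega> \<in> space M. (W \<omega>, V \<omega>, V' \<omega>) \<in> R} = (\<integral>x. measure (\<nu> \<Otimes>\<^sub>M \<nu>) (Pair x -` R) \<partial>\<mu>)"
    if [measurable]: "R \<in> sets (borel \<Otimes>\<^sub>M (borel \<Otimes>\<^sub>M borel))" for R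
  proof -
    have "prob {\<omega> \<in> space M. (W \<omega>, V \<omega>, V' \<omega>) \<in> R} = measure (\<mu> \<Otimes>\<^sub>M (\<nu> \<Otimes>\<^sub>M \<nu>)) R"
      unfolding triple[symmetric]
      by (subst measure_distr) (auto intro!: arg_cong[where f=prob])
    also have "\<dots> = (\<integral>x. measure (\<nu> \<Otimes>\<^sub>M \<nu>) (Pair x -` R) \<partial>\<mu>)"
      by (rule P.measure_eq_integral_measure) (simp cong: sets_pair_measure_cong)
    finally show ?thesis .
  qed
  have sets_less: "{z. f z < a} \<in> sets (borel \<Otimes>\<^sub>M (borel \<Otimes>\<^sub>M borel))"
    if [measurable]: "f \<in> borel_measurable (borel \<Otimes>\<^sub>M (borel \<Otimes>\<^sub>M borel))" for f :: "real \<times> real \<times> real \<Rightarrow> real"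
  proof -
    have "{z \<in> space (borel \<Otimes>\<^sub>M (borel \<Otimes>\<^sub>M borel)). f z < a} \<in> sets (borel \<Otimes>\<^sub>M (borel \<Otimes>\<^sub>M borel))"
      by measurable
    then show ?thesis by (simp add: space_pair_measure)
  qed
  let ?R = "{z :: real \<times> real \<times> real. fst z + fst (snd z) < a}"
  let ?R' = "{z :: real \<times> real \<times> real. fst z + snd (snd z) < a}"
  have R: "?R \<in> sets (borel \<Otimes>\<^sub>M (borel \<Otimes>\<^sub>M borel))" "?R' \<in> sets (borel \<Otimes>\<^sub>M (borel \<Otimes>\<^sub>M borel))"
    by (auto intro!: sets_less)
  \<comment> \<open>The two conditions restrict separate variables by the same threshold, so each
    section is a square, of measure \<open>(g x)\<^sup>2\<close>.\<close>
  have "Pair x -` (?R \<inter> ?R') = {y. x + y < a} \<times> {y. x + y < a}" for x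
    by auto
  then have 1: "prob {\<omega> \<in> space M. W \<omega> + V \<omega> < a \<and> W \<omega> + V' \<omega> < a} = (\<integral>x. (g x)\<^sup>2 \<partial>\<mu>)"
    using joint[OF sets.Int[OF R]] by (simp add: g_def power2_eq_square times)
  have "Pair x -` ?R = {y. x + y < a} \<times> UNIV" for x
    by auto
  then have 2: "prob {\<omega> \<in> space M. W \<omega> + V \<omega> < a} = (\<integral>x. g x \<partial>\<mu>)"
    using joint[OF R(1)] \<nu>.prob_space by (simp add: g_def times)
  have int: "integrable \<mu> g" "integrable \<mu> (\<lambda>x. (g x)\<^sup>2)"
    using g by (auto intro!: \<mu>.integrable_const_bound[where B=1] simp: power_le_one)
  have "0 \<le> \<mu>.variance g" by (rule \<mu>.variance_positive)
  then show ?thesis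
    using \<mu>.variance_eq[OF int] by (simp add: 1 2)
qed

subsection \<open>Independent Gaussian coordinates\<close>

text \<open>The noise is a plain family of real variables, so that a codeword can be represented by
  its support, a set of indices.\<close>

locale iid_gaussian = prob_space M for M :: "'a measure" +
  fixes X :: "'i::finite \<Rightarrow> 'a \<Rightarrow> real" and \<sigma> :: real
  assumes sigma: "0 < \<sigma>"
    and indep: "indep_vars (\<lambda>_. borel) X UNIV"
    and normal: "\<And>t. distributed M lborel (X t) (normal_density 0 \<sigma>)"
begin

text \<open>For the support \<open>S\<close> of a word this says that the word is nearer to the
  received vector than the zero word; see \<open>closer_iff\<close>.\<close>

definition beats :: "'i set \<Rightarrow> 'a \<Rightarrow> bool" where
  "beats S \<omega> \<longleftrightarrow> (\<Sum>t\<in>S. X t \<omega>) < - real (card S)"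

text \<open>The zero word is sent as the all-one vector, so the hard decision at \<open>t\<close> is
  wrong iff \<open>1 + X t \<omega> \<le> 0\<close>.\<close>

definition errs :: "'i set \<Rightarrow> 'a \<Rightarrow> nat" where
  "errs T \<omega> = card {t\<in>T. X t \<omega> \<le> -1}"

definition pb :: real where "pb = Q (1 / \<sigma>)"

lemma X_measurable [measurable]: "X t \<in> borel_measurable M"
  using distributed_measurable[OF normal[of t]] by simp

lemma beats_measurable [measurable]: "Measurable.pred M (beats S)"
  unfolding beats_def by measurable

lemma errs_eq_sum: "errs T \<omega> = (\<Sum>t\<in>T. of_bool (X t \<omega> \<le> -1))"
  unfolding errs_def by (simp add: of_bool_def sum.If_cases Int_def)

lemma errs_measurable [measurable]: "errs T \<in> measurable M (count_space UNIV)"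
  unfolding errs_eq_sum[abs_def] by measurable

text \<open>The sum over \<open>S\<close> has variance \<open>card S * \<sigma>\<^sup>2\<close>, so
  the threshold lies \<open>sqrt (card S) / \<sigma>\<close> standard deviations below the mean. An
  empty sum has no density.\<close>

lemma prob_beats:
  assumes "S \<noteq> {}"
  shows "prob {\<omega> \<in> space M. beats S \<omega>} = Q (sqrt (card S) / \<sigma>)"
proof -
  have "distributed M lborel (\<lambda>\<omega>. \<Sum>t\<in>S. X t \<omega>)
      (normal_density (\<Sum>t\<in>S. 0) (sqrt (\<Sum>t\<in>S. \<sigma>\<^sup>2)))"
    using assms sigma normal indep_vars_subset[OF indep subset_UNIV]
    by (intro sum_indep_normal) auto
  then have D: "distributed M lborel (\<lambda>\<omega>. \<Sum>t\<in>S. X t \<omega>) (normal_density 0 (sqrt (card S) * \<sigma>))"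
    using sigma by (simp add: real_sqrt_mult)
  have c: "0 < real (card S)"
    using assms by (simp add: card_gt_0_iff)
  have "real (card S) / (sqrt (card S) * \<sigma>) = sqrt (card S) / \<sigma>"
    using c sigma by (simp add: real_div_sqrt flip: divide_divide_eq_left)
  with prob_normal_tail(2)[OF _ _ D, of "card S"] c sigma show ?thesis
    unfolding beats_def by (simp add: prob_space_axioms)
qed

text \<open>Composing \<open>F\<close> and \<open>G\<close> with restricted families shows which
  coordinates each event reads; disjoint blocks of coordinates are independent.\<close>

lemma prob_disjoint_coordinates:
  assumes "S \<inter> T = {}"
    and [measurable]: "Measurable.pred (PiM S (\<lambda>_. borel)) F" "Measurable.pred (PiM T (\<lambda>_. borel)) G"
  shows "prob {\<omega> \<in> space M. F (\<lambda>t\<in>S. X t \<omega>) \<and> G (\<lambda>t\<in>T. X t \<omega>)}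
    = prob {\<omega> \<in> space M. F (\<lambda>t\<in>S. X t \<omega>)} * prob {\<omega> \<in> space M. G (\<lambda>t\<in>T. X t \<omega>)}"
proof -
  have "indep_var (PiM S (\<lambda>_. borel)) (\<lambda>\<omega>. \<lambda>t\<in>S. X t \<omega>) (PiM T (\<lambda>_. borel)) (\<lambda>\<omega>. \<lambda>t\<in>T. X t \<omega>)"
    using indep_var_restrict[OF indep assms(1)] by simp
  from indep_varD[OF indep_var_compose[OF this assms(2,3)], of "{True}" "{True}"]
  show ?thesis
    by (simp add: vimage_def Int_def conj_commute)
qed

section \<open>Binomial law of the number of bit errors\<close>

lemma prob_error: "prob {\<omega> \<in> space M. X t \<omega> \<le> -1} = pb"
  using prob_normal_tail(1)[OF prob_space_axioms sigma normal, of t 1] by (simp add: pb_def)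

lemma pb_bounds: "0 \<le> pb" "pb \<le> 1"
  using prob_error[of undefined] measure_nonneg prob_le_1 by metis+

lemma prob_error_pattern:
  assumes "U \<subseteq> T"
  shows "prob {\<omega> \<in> space M. {t\<in>T. X t \<omega> \<le> -1} = U} = pb ^ card U * (1 - pb) ^ (card T - card U)"
proof -
  \<comment> \<open>Indices outside \<open>T\<close> get the whole line, hence the factor 1, so the
    product can run over all indices.\<close>
  define D where "D t = (if t \<in> U then {..-1} else if t \<in> T then {-1<..} else (UNIV :: real set))" for t
  have "{\<omega> \<in> space M. {t\<in>T. X t \<omega> \<le> -1} = U} = (\<Inter>t\<in>UNIV. X t -` D t \<inter> space M)"
    using assms by (fastforce simp: D_def split: if_splits)
  also have "prob \<dots> = (\<Prod>t\<in>UNIV. prob (X t -` D t \<inter> space M))"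
    by (rule indep_varsD_finite[OF indep]) (auto simp: D_def)
  also have "\<dots> = (\<Prod>t\<in>UNIV. if t \<in> U then pb else if t \<in> T then 1 - pb else 1)"
  proof (rule prod.cong)
    fix t
    have "prob {\<omega> \<in> space M. \<not> X t \<omega> \<le> -1} = 1 - pb"
      by (subst prob_neg) (auto simp: prob_error)
    then show "prob (X t -` D t \<inter> space M) = (if t \<in> U then pb else if t \<in> T then 1 - pb else 1)"
      using prob_error[of t] prob_space
      by (auto simp: D_def vimage_def Int_def conj_commute not_le)
  qed simp
  also have "\<dots> = pb ^ card U * (1 - pb) ^ card (T - U)"
    using assms by (simp add: prod.If_cases Diff_eq Int_commute)
  finally show ?thesis
    using assms by (simp add: card_Diff_subset finite_subset)
qed

text \<open>The error sets of size \<open>m\<close> are equiprobable, and there are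
  \<open>card T choose m\<close> of them. \<open>k\<close> is an integer because \<open>-1\<close>
  occurs when no errors are allowed; both sides are then 0.\<close>

lemma prob_errs_le:
  "prob {\<omega> \<in> space M. int (errs T \<omega>) \<le> k} = B pb (card T) 0 k"
proof -
  let ?F = "{U. U \<subseteq> T \<and> int (card U) \<le> k}"
  have "prob {\<omega> \<in> space M. int (errs T \<omega>) \<le> k}
      = prob (\<Union>U\<in>?F. {\<omega> \<in> space M. {t\<in>T. X t \<omega> \<le> -1} = U})"
    by (rule arg_cong[where f=prob]) (auto simp: errs_def)
  also have "\<dots> = (\<Sum>U\<in>?F. prob {\<omega> \<in> space M. {t\<in>T. X t \<omega> \<le> -1} = U})"
    by (rule finite_measure_finite_Union) (auto simp: disjoint_family_on_def set_eq_iff)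
  also have "\<dots> = (\<Sum>U\<in>?F. pb ^ card U * (1 - pb) ^ (card T - card U))"
    by (intro sum.cong refl prob_error_pattern) auto
  also have "\<dots> = (\<Sum>m | 0 \<le> int m \<and> int m \<le> k.
      \<Sum>U\<in>{U \<in> ?F. card U = m}. pb ^ card U * (1 - pb) ^ (card T - card U))"
  proof (rule sum.group[symmetric])
    show "finite {m. 0 \<le> int m \<and> int m \<le> k}"
      by (rule finite_subset[of _ "{..nat k}"]) auto
  qed auto
  also have "\<dots> = B pb (card T) 0 k"
    unfolding B_def
  proof (rule sum.cong)
    fix m assume "m \<in> {m. 0 \<le> int m \<and> int m \<le> k}"
    then have "{U \<in> ?F. card U = m} = {U. U \<subseteq> T \<and> card U = m}"
      by auto
    then show "(\<Sum>U\<in>{U \<in> ?F. card U = m}. pb ^ card U * (1 - pb) ^ (card T - card U))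
        = real (card T choose m) * pb ^ m * (1 - pb) ^ (card T - m)"
      using n_subsets[of T m] by simp
  qed simp
  finally show ?thesis .
qed

lemma prob_and_errs_le:
  assumes "S \<inter> T = {}" and [measurable]: "Measurable.pred (PiM S (\<lambda>_. borel)) F"
  shows "prob {\<omega> \<in> space M. F (\<lambda>t\<in>S. X t \<omega>) \<and> int (errs T \<omega>) \<le> k}
    = prob {\<omega> \<in> space M. F (\<lambda>t\<in>S. X t \<omega>)} * B pb (card T) 0 k"
proof -
  \<comment> \<open>The count is rewritten as a function of the coordinates in \<open>T\<close>
    alone, the form that independence requires.\<close>
  let ?G = "\<lambda>f :: 'i \<Rightarrow> real. int (\<Sum>t\<in>T. of_bool (f t \<le> (-1::real))) \<le> k"
  have "(\<lambda>f. \<Sum>t\<in>T. of_bool (f t \<le> (-1::real)) :: nat) \<in> measurable (PiM T (\<lambda>_. borel)) (count_space UNIV)"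
    by measurable
  then have G: "Measurable.pred (PiM T (\<lambda>_. borel)) ?G"
    by (rule measurable_compose) simp
  have errs: "?G (\<lambda>t\<in>T. X t \<omega>) \<longleftrightarrow> int (errs T \<omega>) \<le> k" for \<omega>
    by (simp add: errs_eq_sum)
  show ?thesis
    using prob_disjoint_coordinates[OF assms G] unfolding errs by (simp add: prob_errs_le)
qed

lemma prob_beats_errs_le:
  assumes "S \<noteq> {}" "S \<inter> T = {}"
  shows "prob {\<omega> \<in> space M. beats S \<omega> \<and> int (errs T \<omega>) \<le> k}
    = Q (sqrt (card S) / \<sigma>) * B pb (card T) 0 k"
proof -
  have "Measurable.pred (PiM S (\<lambda>_. borel)) (\<lambda>f. (\<Sum>t\<in>S. f t) < - real (card S))"
    by measurable
  from prob_and_errs_le[OF assms(2) this, of k] prob_beats[OF assms(1)] show ?thesis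
    by (simp add: beats_def)
qed

lemma prob_beats_not_beats_errs_le:
  assumes "(S \<union> S') \<inter> T = {}"
  shows "prob {\<omega> \<in> space M. (beats S \<omega> \<and> \<not> beats S' \<omega>) \<and> int (errs T \<omega>) \<le> k}
    = prob {\<omega> \<in> space M. beats S \<omega> \<and> \<not> beats S' \<omega>} * B pb (card T) 0 k"
proof -
  have "Measurable.pred (PiM (S \<union> S') (\<lambda>_. borel)) (\<lambda>f. (\<Sum>t\<in>S. f t) < - real (card S)
    \<and> \<not> (\<Sum>t\<in>S'. f t) < - real (card S'))"
    by measurable
  from prob_and_errs_le[OF assms this, of k] show ?thesis
    by (simp add: beats_def)
qed

text \<open>For distinct supports the events interact only through the noise on
  \<open>S \<inter> S'\<close>. The remaining sums \<open>?V\<close> and \<open>?V'\<close> are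
  independent, and they have the same law because \<open>S - S'\<close> and \<open>S' - S\<close>
  have equally many elements.\<close>

lemma prob_beats_and_beats_ge:
  assumes card: "card S = card S'" and ne: "S \<noteq> {}"
  shows "(Q (sqrt (card S) / \<sigma>))\<^sup>2 \<le> prob {\<omega> \<in> space M. beats S \<omega> \<and> beats S' \<omega>}"
proof (cases "S = S'")
  \<comment> \<open>Here the sums over the differences would be empty and have no normal density, so
    this case is settled by \<open>?q\<^sup>2 \<le> ?q\<close>.\<close>
  case True
  let ?q = "Q (sqrt (card S) / \<sigma>)"
  have "0 \<le> ?q" "?q \<le> 1"
    using prob_beats[OF ne] measure_nonneg prob_le_1 by metis+
  then have "?q\<^sup>2 \<le> ?q"
    by (simp add: power2_eq_square mult_left_le)
  with True prob_beats[OF ne] show ?thesis by simp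
next
  case False
  let ?s = "\<lambda>A f. \<Sum>t\<in>A. f t :: real"
  let ?W = "\<lambda>\<omega>. \<Sum>t\<in>S \<inter> S'. X t \<omega>"
  let ?V = "\<lambda>\<omega>. \<Sum>t\<in>S - S'. X t \<omega>"
  let ?V' = "\<lambda>\<omega>. \<Sum>t\<in>S' - S. X t \<omega>"
  let ?D = "(S - S') \<union> (S' - S)"
  have cardD: "card (S - S') = card (S' - S)"
    using card by (simp add: card_Diff_subset_Int Int_commute)
  have neD: "S - S' \<noteq> {}" "S' - S \<noteq> {}"
    using False cardD by (metis Diff_eq_empty_iff card_0_eq card_subset_eq card finite subset_antisym)+
  have dist: "distributed M lborel (\<lambda>\<omega>. \<Sum>t\<in>A. X t \<omega>) (normal_density 0 (sqrt (card A * \<sigma>\<^sup>2)))"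
    if "A \<noteq> {}" for A
    using sum_indep_normal[of A X "\<lambda>_. \<sigma>" "\<lambda>_. 0"] that sigma normal indep_vars_subset[OF indep subset_UNIV]
    by simp
  have eq: "distr M borel ?V' = distr M borel ?V"
    using dist[OF neD(1)] dist[OF neD(2)] cardD
    by (metis distributed_distr_eq_density distr_cong sets_lborel)
  have rind: "indep_var (PiM A (\<lambda>_. borel)) (\<lambda>\<omega>. \<lambda>t\<in>A. X t \<omega>) (PiM B (\<lambda>_. borel)) (\<lambda>\<omega>. \<lambda>t\<in>B. X t \<omega>)"
    if "A \<inter> B = {}" for A B
    using indep_var_restrict[OF indep that] by simp
  have "indep_var borel (?s (S - S') \<circ> (\<lambda>\<omega>. \<lambda>t\<in>S - S'. X t \<omega>)) borel (?s (S' - S) \<circ> (\<lambda>\<omega>. \<lambda>t\<in>S' - S. X t \<omega>))"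
    by (rule indep_var_compose[OF rind]) auto
  then have indV: "indep_var borel ?V borel ?V'"
    by (simp add: comp_def)
  \<comment> \<open>Both \<open>?V\<close> and \<open>?V'\<close> read only the block
    \<open>?D\<close>, disjoint from \<open>S \<inter> S'\<close>. Hence the pair, and not just each
    sum, is independent of \<open>?W\<close>.\<close>
  have "distr M (borel \<Otimes>\<^sub>M (borel \<Otimes>\<^sub>M borel))
      (\<lambda>\<omega>. (?s (S \<inter> S') (\<lambda>t\<in>S \<inter> S'. X t \<omega>), (\<lambda>f. (?s (S - S') f, ?s (S' - S) f)) (\<lambda>t\<in>?D. X t \<omega>)))
    = distr M borel (\<lambda>\<omega>. ?s (S \<inter> S') (\<lambda>t\<in>S \<inter> S'. X t \<omega>)) \<Otimes>\<^sub>M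
      distr M (borel \<Otimes>\<^sub>M borel) (\<lambda>\<omega>. (\<lambda>f. (?s (S - S') f, ?s (S' - S) f)) (\<lambda>t\<in>?D. X t \<omega>))"
    by (rule distr_pair_compose_indep[OF rind]) (auto, measurable)
  moreover have "?s (S \<inter> S') (\<lambda>t\<in>S \<inter> S'. X t \<omega>) = ?W \<omega>"
    "?s (S - S') (\<lambda>t\<in>?D. X t \<omega>) = ?V \<omega>" "?s (S' - S) (\<lambda>t\<in>?D. X t \<omega>) = ?V' \<omega>" for \<omega>
    by (auto intro!: sum.cong)
  ultimately have ind: "distr M (borel \<Otimes>\<^sub>M (borel \<Otimes>\<^sub>M borel)) (\<lambda>\<omega>. (?W \<omega>, ?V \<omega>, ?V' \<omega>))
    = distr M borel ?W \<Otimes>\<^sub>M distr M (borel \<Otimes>\<^sub>M borel) (\<lambda>\<omega>. (?V \<omega>, ?V' \<omega>))"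
    by simp
  have "beats S \<omega> \<longleftrightarrow> ?W \<omega> + ?V \<omega> < - real (card S)" "beats S' \<omega> \<longleftrightarrow> ?W \<omega> + ?V' \<omega> < - real (card S)" for \<omega>
    using sum.Int_Diff[of S "\<lambda>t. X t \<omega>" S'] sum.Int_Diff[of S' "\<lambda>t. X t \<omega>" S] card
    by (simp_all add: beats_def Int_commute)
  then show ?thesis
    using prob_shared_summand_ge[OF _ ind indV eq, of "- real (card S)"] prob_beats[OF ne] by simp
qed

lemma prob_beats_not_beats_le:
  assumes card: "card S = card S'" and ne: "S \<noteq> {}"
  shows "prob {\<omega> \<in> space M. beats S \<omega> \<and> \<not> beats S' \<omega>}
    \<le> Q (sqrt (card S) / \<sigma>) - (Q (sqrt (card S) / \<sigma>))\<^sup>2"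
proof -
  have "{\<omega> \<in> space M. beats S \<omega> \<and> \<not> beats S' \<omega>}
      = {\<omega> \<in> space M. beats S \<omega>} - {\<omega> \<in> space M. beats S \<omega> \<and> beats S' \<omega>}"
    by auto
  also have "prob \<dots> = prob {\<omega> \<in> space M. beats S \<omega>} - prob {\<omega> \<in> space M. beats S \<omega> \<and> beats S' \<omega>}"
    by (rule finite_measure_Diff) auto
  finally show ?thesis
    using prob_beats[OF ne] prob_beats_and_beats_ge[OF assms] by simp
qed

section \<open>Union bounds over a family of supports\<close>

lemma beats_errs_less:
  assumes "beats S \<omega>" "S \<inter> T = {}"
  shows "errs T \<omega> < errs UNIV \<omega>"
proof -
  \<comment> \<open>A sum below \<open>- card S\<close> cannot have all its terms above -1. The
    error found lies outside \<open>T\<close>; it accounts for the \<open>- 1\<close> in the later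
    error counts.\<close>
  have "\<exists>t\<in>S. X t \<omega> \<le> -1"
  proof (rule ccontr)
    assume "\<not> ?thesis"
    then have "(\<Sum>t\<in>S. -1) \<le> (\<Sum>t\<in>S. X t \<omega>)"
      by (intro sum_mono) (auto simp: not_le intro: less_imp_le)
    with assms(1) show False by (simp add: beats_def)
  qed
  then show ?thesis
    unfolding errs_def using assms(2) by (intro psubset_card_mono) auto
qed

text \<open>Each support \<open>S\<close> is paired with its complement: these
  \<open>CARD('i) - d\<close> coordinates are independent of \<open>beats S\<close>, and at least
  one of the \<open>k\<close> admissible errors falls outside them.\<close>

lemma union_bound_independent:
  assumes F: "\<And>S. S \<in> \<F> \<Longrightarrow> card S = d" and "d \<ge> 1"
  shows "prob {\<omega> \<in> space M. (\<exists>S\<in>\<F>. beats S \<omega>) \<and> errs UNIV \<omega> \<le> k}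
    \<le> real (card \<F>) * Q (sqrt d / \<sigma>) * B pb (CARD('i) - d) 0 (int k - 1)"
proof -
  have "prob {\<omega> \<in> space M. (\<exists>S\<in>\<F>. beats S \<omega>) \<and> errs UNIV \<omega> \<le> k}
      \<le> prob (\<Union>S\<in>\<F>. {\<omega> \<in> space M. beats S \<omega> \<and> int (errs (- S) \<omega>) \<le> int k - 1})"
    using beats_errs_less[of _ _ "- _"] by (intro finite_measure_mono) fastforce+
  also have "\<dots> \<le> (\<Sum>S\<in>\<F>. prob {\<omega> \<in> space M. beats S \<omega> \<and> int (errs (- S) \<omega>) \<le> int k - 1})"
    by (rule finite_measure_subadditive_finite) auto
  also have "\<dots> = (\<Sum>S\<in>\<F>. Q (sqrt d / \<sigma>) * B pb (CARD('i) - d) 0 (int k - 1))"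
  proof (rule sum.cong)
    fix S assume "S \<in> \<F>"
    with F \<open>d \<ge> 1\<close> have "card S = d" "S \<noteq> {}" by force+
    then show "prob {\<omega> \<in> space M. beats S \<omega> \<and> int (errs (- S) \<omega>) \<le> int k - 1}
        = Q (sqrt d / \<sigma>) * B pb (CARD('i) - d) 0 (int k - 1)"
      using prob_beats_errs_le[of S "- S" "int k - 1"] by (simp add: Compl_eq_Diff_UNIV card_Diff_subset)
  qed simp
  finally show ?thesis by simp
qed

lemma union_bound_reference:
  assumes F: "\<And>S. S \<in> \<F> \<Longrightarrow> card S = d" and "d \<ge> 1"
  defines "q \<equiv> Q (sqrt d / \<sigma>)"
  shows "prob {\<omega> \<in> space M. (\<exists>S\<in>\<F>. beats S \<omega>) \<and> errs UNIV \<omega> \<le> k}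
    \<le> (real (card \<F>) - 1) * (q - 1 / 2 * q\<^sup>2) * B pb (CARD('i) - 2 * d) 0 (int k - 1) + q"
proof (cases "\<F> = {}")
  case True
  \<comment> \<open>An ensemble may contain codes without words of weight \<open>d\<close>; then the factor
    \<open>card \<F> - 1\<close> is \<open>-1\<close>, and the bound has to be nonnegative.\<close>
  let ?a = "q - 1 / 2 * q\<^sup>2" and ?b = "B pb (CARD('i) - 2 * d) 0 (int k - 1)"
  have q: "0 \<le> q" "q \<le> 1"
    by (simp_all add: q_def Q_bounds)
  then have "q\<^sup>2 \<le> q"
    by (simp add: power2_eq_square mult_left_le)
  then have "0 \<le> ?a"
    using q by simp
  then have "?a * ?b \<le> ?a"
    using B_bounds(2)[OF pb_bounds] by (simp add: mult_left_le)
  also have "?a \<le> q"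
    by simp
  finally have "?a * ?b \<le> q" .
  then show ?thesis
    using True by (simp add: algebra_simps)
next
  case False
  then obtain S0 where S0: "S0 \<in> \<F>" by auto
  with F \<open>d \<ge> 1\<close> have c0: "card S0 = d" "S0 \<noteq> {}" by force+
  let ?b = "B pb (CARD('i) - 2 * d) 0 (int k - 1)"
  \<comment> \<open>The overlap of \<open>S\<close> and \<open>S0\<close> is unknown, so only
    \<open>2 * d\<close> bounds their union. Choosing \<open>T\<close> of exactly the remaining size
    gives all \<open>S\<close> the same factor; \<open>T\<close> is empty if \<open>2 * d\<close>
    exceeds the length.\<close>
  have "\<exists>T. (S \<union> S0) \<inter> T = {} \<and> card T = CARD('i) - 2 * d" if "S \<in> \<F>" for S
  proof -
    have "card (S \<union> S0) \<le> 2 * d"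
      using card_Un_le[of S S0] F[OF that] c0 by simp
    then have "CARD('i) - 2 * d \<le> card (- (S \<union> S0))"
      by (simp add: Compl_eq_Diff_UNIV card_Diff_subset)
    then obtain T where "T \<subseteq> - (S \<union> S0)" "card T = CARD('i) - 2 * d"
      by (meson obtain_subset_with_card_n)
    then show ?thesis by blast
  qed
  then obtain T where T: "\<And>S. S \<in> \<F> \<Longrightarrow> (S \<union> S0) \<inter> T S = {}"
    "\<And>S. S \<in> \<F> \<Longrightarrow> card (T S) = CARD('i) - 2 * d"
    by metis
  let ?A = "\<lambda>S. {\<omega> \<in> space M. (beats S \<omega> \<and> \<not> beats S0 \<omega>) \<and> int (errs (T S) \<omega>) \<le> int k - 1}"
  have less: "errs (T S) \<omega> < errs UNIV \<omega>" if "S \<in> \<F>" "beats S \<omega>" for S \<omega>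
    using beats_errs_less[OF that(2), of "T S"] T(1)[OF that(1)] by blast
  \<comment> \<open>Outcomes at which \<open>S0\<close> wins are charged to \<open>S0\<close> alone,
    without counting errors. Every other outcome lies in \<open>?A S\<close> for some other
    \<open>S\<close>.\<close>
  have "prob {\<omega> \<in> space M. (\<exists>S\<in>\<F>. beats S \<omega>) \<and> errs UNIV \<omega> \<le> k}
      \<le> prob ({\<omega> \<in> space M. beats S0 \<omega>} \<union> (\<Union>S\<in>\<F> - {S0}. ?A S))"
    using less by (intro finite_measure_mono) fastforce+
  also have "\<dots> \<le> prob {\<omega> \<in> space M. beats S0 \<omega>} + prob (\<Union>S\<in>\<F> - {S0}. ?A S)"
    by (rule measure_Un_le) auto
  also have "prob (\<Union>S\<in>\<F> - {S0}. ?A S) \<le> (\<Sum>S\<in>\<F> - {S0}. prob (?A S))"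
    by (rule finite_measure_subadditive_finite) auto
  also have "\<dots> \<le> (\<Sum>S\<in>\<F> - {S0}. (q - 1 / 2 * q\<^sup>2) * ?b)"
  proof (rule sum_mono)
    fix S assume S: "S \<in> \<F> - {S0}"
    then have c: "card S = d" "S \<noteq> {}" using F \<open>d \<ge> 1\<close> by force+
    have "prob {\<omega> \<in> space M. beats S \<omega> \<and> \<not> beats S0 \<omega>} \<le> q - 1 / 2 * q\<^sup>2"
    proof -
      have "prob {\<omega> \<in> space M. beats S \<omega> \<and> \<not> beats S0 \<omega>} \<le> q - q\<^sup>2"
        using prob_beats_not_beats_le[of S S0] c c0 by (simp add: q_def)
      then show ?thesis
        using zero_le_power2[of q] by linarith
    qed
    then show "prob (?A S) \<le> (q - 1 / 2 * q\<^sup>2) * ?b"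
      using prob_beats_not_beats_errs_le[of S S0 "T S" "int k - 1"] T S B_bounds(1)[OF pb_bounds]
      by (simp add: mult_right_mono)
  qed
  also have "\<dots> = (real (card \<F>) - 1) * (q - 1 / 2 * q\<^sup>2) * ?b"
  proof -
    have "real (card \<F>) = real (card (\<F> - {S0})) + 1"
      using card.remove[OF _ S0] by simp
    then show ?thesis by simp
  qed
  finally show ?thesis
    using prob_beats[OF c0(2)] c0(1) by (simp add: q_def)
qed

end
subsection \<open>Codes and ensembles\<close>

definition supp :: "bit ^ 'n \<Rightarrow> 'n set" where
  "supp c = {t. c $ t \<noteq> 0}"

text \<open>A bit is determined by whether it is nonzero. This lets supports be counted in place of
  words and embeds the words into a finite power set.\<close>

lemma inj_supp: "inj supp"
proof (rule injI)
  fix c c' :: "bit ^ 'n"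
  assume "supp c = supp c'"
  then have "c $ t = 0 \<longleftrightarrow> c' $ t = 0" for t
    by (simp only: supp_def set_eq_iff mem_Collect_eq) blast
  then have "c $ t = c' $ t" for t
    by (metis bit.exhaust)
  then show "c = c'"
    by (simp add: vec_eq_iff)
qed

lemma finite_words: "finite (A :: (bit ^ 'n) set)"
  by (rule inj_on_finite[OF inj_on_subset[OF inj_supp subset_UNIV] subset_UNIV finite])

text \<open>In the difference of the squared distances only the coordinates of the support
  survive, each contributing \<open>(y\<^sub>t + 1)\<^sup>2 - (y\<^sub>t - 1)\<^sup>2 = 4 y\<^sub>t\<close>.\<close>

lemma closer_iff:
  "dist (received z) (bpsk c) < dist (received z) (bpsk 0)
    \<longleftrightarrow> (\<Sum>t\<in>supp c. z $ t) < - real (card (supp c))"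
proof -
  let ?y = "received z"
  have y: "?y $ t = 1 + z $ t" for t
    by (simp add: received_def bpsk_def)
  have sq: "(dist ?y v)\<^sup>2 = (\<Sum>t\<in>UNIV. (?y $ t - v $ t)\<^sup>2)" for v
    by (simp add: dist_vec_def L2_set_def dist_real_def sum_nonneg)
  have "(dist ?y (bpsk c))\<^sup>2 - (dist ?y (bpsk 0))\<^sup>2
      = (\<Sum>t\<in>UNIV. if t \<in> supp c then 4 * ?y $ t else 0)"
    unfolding sq sum_subtractf[symmetric]
    by (rule sum.cong) (auto simp: bpsk_def supp_def power2_eq_square algebra_simps)
  also have "\<dots> = 4 * (real (card (supp c)) + (\<Sum>t\<in>supp c. z $ t))"
    by (simp add: sum.If_cases y sum.distrib flip: sum_distrib_left)
  finally have "(dist ?y (bpsk c))\<^sup>2 < (dist ?y (bpsk 0))\<^sup>2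
      \<longleftrightarrow> (\<Sum>t\<in>supp c. z $ t) < - real (card (supp c))"
    by (smt (verit))
  then show ?thesis
    using power_less_imp_less_base power_strict_mono[of _ _ 2] by (metis zero_le_dist zero_less_numeral)
qed

context iid_gaussian
begin

text \<open>Passes from words to supports. As \<open>supp\<close> is injective, \<open>\<F>\<close>
  has exactly \<open>weight_spectrum C d\<close> members, and the union bounds carry over.\<close>

lemma prob_code_le:
  fixes C :: "(bit ^ 'i) set" and Z :: "'a \<Rightarrow> real ^ 'i"
  assumes X: "X = (\<lambda>t \<omega>. Z \<omega> $ t)" and "d \<ge> 1"
  defines "q \<equiv> Q (sqrt d / \<sigma>)" and "p \<equiv> Q (1 / \<sigma>)" and "A \<equiv> real (weight_spectrum C d)"
    and "n \<equiv> CARD('i)"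
  shows "prob {\<omega> \<in> space M. error_event d C (received (Z \<omega>)) \<and>
      hamming_weight (hard_decision (received (Z \<omega>))) \<le> k}
    \<le> A * q * B p (n - d) 0 (int k - 1)" (is "?P \<le> _")
    and "prob {\<omega> \<in> space M. error_event d C (received (Z \<omega>)) \<and>
      hamming_weight (hard_decision (received (Z \<omega>))) \<le> k}
    \<le> (A - 1) * (q - 1 / 2 * q\<^sup>2) * B p (n - 2 * d) 0 (int k - 1) + q"
proof -
  have X': "X t \<omega> = Z \<omega> $ t" for t \<omega>
    by (simp add: X)
  define \<F> where "\<F> = supp ` {c \<in> C. hamming_weight c = d}"
  have card: "card S = d" if "S \<in> \<F>" for S
    using that by (auto simp: \<F>_def supp_def hamming_weight_def)
  have A: "A = real (card \<F>)"
    by (simp add: A_def \<F>_def weight_spectrum_def card_image inj_on_subset[OF inj_supp])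
  have "error_event d C (received (Z \<omega>)) \<longleftrightarrow> (\<exists>S\<in>\<F>. beats S \<omega>)" for \<omega>
    by (auto simp: error_event_def closer_iff \<F>_def beats_def X')
  moreover have "hamming_weight (hard_decision (received (Z \<omega>))) = errs UNIV \<omega>" for \<omega>
    by (auto simp: hamming_weight_def hard_decision_def received_def bpsk_def errs_def X'
      intro!: arg_cong[where f=card])
  ultimately have P: "?P = prob {\<omega> \<in> space M. (\<exists>S\<in>\<F>. beats S \<omega>) \<and> errs UNIV \<omega> \<le> k}"
    by simp
  show "?P \<le> A * q * B p (n - d) 0 (int k - 1)"
    using union_bound_independent[OF card \<open>d \<ge> 1\<close>, of \<F> k]
    by (simp add: P A q_def p_def n_def pb_def)
  show "?P \<le> (A - 1) * (q - 1 / 2 * q\<^sup>2) * B p (n - 2 * d) 0 (int k - 1) + q"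
    using union_bound_reference[OF card \<open>d \<ge> 1\<close>, of \<F> k]
    by (simp add: P A q_def p_def n_def pb_def)
qed

end

section \<open>Averaging over the ensemble\<close>

lemma ensemble_prob_le_affine:
  fixes P :: "(bit ^ 'n) set pmf"
  assumes "\<And>C. measure M {\<omega> \<in> space M. X C \<omega>} \<le> a * real (weight_spectrum C d) + b"
  shows "ensemble_prob P M X \<le> a * average_weight_spectrum P d + b"
proof -
  have "finite (Pow (UNIV :: (bit ^ 'n) set))"
    using finite_words by (simp only: finite_Pow_iff)
  then have fin: "finite (set_pmf P)"
    by (rule rev_finite_subset) simp
  have "ensemble_prob P M X \<le> (\<Sum>C\<in>set_pmf P. pmf P C * (a * real (weight_spectrum C d) + b))"
    unfolding ensemble_prob_def by (intro sum_mono mult_left_mono assms) simp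
  \<comment> \<open>The probabilities of the codes sum to 1, so the intercept \<open>b\<close>
    survives averaging unchanged.\<close>
  also have "\<dots> = a * average_weight_spectrum P d + b * (\<Sum>C\<in>set_pmf P. pmf P C)"
    by (simp add: average_weight_spectrum_def algebra_simps sum.distrib sum_distrib_left)
  also have "(\<Sum>C\<in>set_pmf P. pmf P C) = 1"
    using fin by (intro sum_pmf_eq_1) auto
  finally show ?thesis by simp
qed

theorem theorem4:
  fixes P :: "(bit ^ 'n) set pmf"
    and M :: "'w measure"
    and Z :: "'w \<Rightarrow> real ^ 'n"
    and \<sigma> :: real
    and d dstar :: nat
  assumes linear: "\<forall>C\<in>set_pmf P. vec.subspace C"
    and prob: "prob_space M"
    and sigma: "\<sigma> > 0"
    and indep: "prob_space.indep_vars M (\<lambda>_. borel) (\<lambda>t \<omega>. Z \<omega> $ t) UNIV"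
    and normal: "\<forall>t. distributed M lborel (\<lambda>\<omega>. Z \<omega> $ t) (\<lambda>x. ennreal (normal_density 0 \<sigma> x))"
    and d: "d \<ge> 1"
    and dstar: "dstar \<le> CARD('n)"
  shows "ensemble_prob P M
      (\<lambda>C \<omega>. error_event d C (received (Z \<omega>)) \<and>
             hamming_weight (hard_decision (received (Z \<omega>))) \<le> dstar)
    \<le> h \<sigma> CARD('n) d dstar (average_weight_spectrum P d)"
proof -
  interpret prob_space M by (rule prob)
  interpret iid_gaussian M "\<lambda>t \<omega>. Z \<omega> $ t" \<sigma>
    using sigma indep normal by unfold_locales auto
  let ?q = "Q (sqrt (real d) / \<sigma>)" and ?p = "Q (1 / \<sigma>)" and ?n = "CARD('n)"
  let ?A = "average_weight_spectrum P d"
  let ?X = "\<lambda>C \<omega>. error_event d C (received (Z \<omega>)) \<and>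
    hamming_weight (hard_decision (received (Z \<omega>))) \<le> dstar"
  let ?B1 = "B ?p (?n - d) 0 (int dstar - 1)" and ?B2 = "B ?p (?n - 2 * d) 0 (int dstar - 1)"
  \<comment> \<open>Slope and intercept of the second bound as a function of the number
    \<open>x\<close> of words; the first bound has intercept 0.\<close>
  have affine: "(x - 1) * a * b + q = a * b * x + (q - a * b)" for x a b q :: real
    by (simp add: algebra_simps)
  have "ensemble_prob P M ?X \<le> ?q * ?B1 * ?A + 0"
    by (rule ensemble_prob_le_affine)
       (use prob_code_le(1)[OF refl d, of _ dstar] in \<open>simp add: mult_ac\<close>)
  then have "ensemble_prob P M ?X \<le> ?A * ?q * ?B1"
    by (simp add: mult_ac)
  moreover have "ensemble_prob P M ?X \<le> (?A - 1) * (?q - 1 / 2 * ?q\<^sup>2) * ?B2 + ?q"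
    unfolding affine
    by (rule ensemble_prob_le_affine) (rule prob_code_le(2)[OF refl d, unfolded affine])
  ultimately show ?thesis
    unfolding h_def Let_def by (rule min.boundedI)
qed

end
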